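(* Let $n\ge 1$ and, for $0\le k\le n-1$, let $D_k$ be the $n\times n$ diagonal matrix with $D_k(q,q)=e^{\sqrt{-1}\,\frac{2\pi kq}{n}}$ for $0\le q\le n-1$. Let $A$ be an $n\times n$ complex matrix with decomposition $A=\sum_{k=0}^{n-1}R_kD_k$, where each $R_k$ is circulant. Then $\langle D_i,D_j\rangle_F=n\,\delta_{i,j}$ for all $0\le i,j\le n-1$, and $\langle R_iD_i,R_jD_j\rangle_F=0$ whenever $i\ne j$.
   Context: Rows and columns of $n\times n$ matrices are indexed by $0,1,\dots,n-1$. A matrix $R$ is circulant if $R(p,q)$ depends only on $p-q \bmod n$. The Frobenius inner product is $\langle A,B\rangle_F=\sum_{p,q}\overline{A(p,q)}\,B(p,q)$. $\delta_{i,j}=1$ if $i=j$ and $0$ otherwise. *)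

theory Defs
  imports Complex_Main "HOL-Number_Theory.Cong" "Jordan_Normal_Form.Matrix"
begin

definition circulant_mat :: "nat \<Rightarrow> 'a mat \<Rightarrow> bool" where
  "circulant_mat n R \<longleftrightarrow> R \<in> carrier_mat n n \<and>
     (\<forall>p<n. \<forall>q<n. \<forall>p'<n. \<forall>q'<n.
        [int p - int q = int p' - int q'] (mod int n) \<longrightarrow> R $$ (p, q) = R $$ (p', q'))"

text \<open>Conjugate-linear in the first argument. Meaningful only for matrices of equal dimensions.\<close>

definition frobenius_inner :: "complex mat \<Rightarrow> complex mat \<Rightarrow> complex" where
  "frobenius_inner A B =
     (\<Sum>p<dim_row A. \<Sum>q<dim_col A. cnj (A $$ (p, q)) * B $$ (p, q))"

definition fourier_diag :: "nat \<Rightarrow> nat \<Rightarrow> complex mat" where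
  "fourier_diag n k =
     mat_diag n (\<lambda>q. exp (\<i> * complex_of_real (2 * pi * real k * real q / real n)))"

end

theory Submission
  imports Defs
begin

text \<open>
  Both claims reduce to the orthogonality of the characters of the cyclic group of order \<open>n\<close>.
  Right multiplication by a diagonal matrix scales columns, so the inner product of
  \<open>R\<^sub>i D\<^sub>i\<close> and \<open>R\<^sub>j D\<^sub>j\<close> is the sum over columns \<open>q\<close> of the number
  \<open>cnj (D\<^sub>i(q,q)) D\<^sub>j(q,q)\<close> times the \<open>q\<close>-th column sum of the entrywise product of
  \<open>cnj R\<^sub>i\<close> and \<open>R\<^sub>j\<close>. That entrywise product is again circulant, and the columns of a
  circulant matrix are cyclic shifts of one another, so its column sums are all equal (lemma
  \<open>circulant_column_sum\<close>). The common value factors out and leaves the character sum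
  (lemma \<open>fourier_character_orthogonality\<close>), which vanishes for \<open>i \<noteq> j\<close>.
  The inner product of \<open>D\<^sub>i\<close> and \<open>D\<^sub>j\<close> is that character sum itself.
\<close>

definition fourier_character :: "nat \<Rightarrow> nat \<Rightarrow> nat \<Rightarrow> complex" where
  "fourier_character n k q = exp (\<i> * complex_of_real (2 * pi * real k * real q / real n))"

lemma fourier_diag_eq_mat_diag: "fourier_diag n k = mat_diag n (fourier_character n k)"
  by (simp add: fourier_diag_def fourier_character_def[abs_def])

text \<open>
  For \<open>i \<noteq> j\<close> the summands are the powers of \<open>\<omega> = cis (2 \<pi> (j - i) / n)\<close>, an
  \<open>n\<close>-th root of unity; it differs from 1 because \<open>0 < \<bar>j - i\<bar> < n\<close>, so the geometric
  sum is \<open>(\<omega>\<^sup>n - 1) / (\<omega> - 1) = 0\<close>.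
\<close>

lemma fourier_character_orthogonality:
  assumes "i < n" "j < n"
  shows "(\<Sum>q<n. cnj (fourier_character n i q) * fourier_character n j q)
           = (if i = j then of_nat n else 0)"
proof -
  define \<omega> where "\<omega> = cis (2 * pi * (real j - real i) / real n)"
  have n: "real n > 0" using assms by simp
  have "cnj (fourier_character n i q) * fourier_character n j q = \<omega> ^ q" for q
    unfolding fourier_character_def \<omega>_def cis_conv_exp[symmetric] cis_cnj cis_mult DeMoivre
    by (rule arg_cong[of _ _ cis]) (simp add: diff_divide_distrib algebra_simps)
  then have sum: "(\<Sum>q<n. cnj (fourier_character n i q) * fourier_character n j q) = (\<Sum>q<n. \<omega> ^ q)"
    by simp
  show ?thesis
  proof (cases "i = j")
    case True
    then show ?thesis unfolding sum by (simp add: \<omega>_def)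
  next
    case False
    have "\<omega> ^ n = cis (2 * pi * (real j - real i))"
      unfolding \<omega>_def DeMoivre using n by simp
    also have "\<dots> = 1"
      by (rule cis_multiple_2pi) simp
    finally have root: "\<omega> ^ n = 1" .
    have "\<omega> \<noteq> 1"
    proof
      assume "\<omega> = 1"
      then have "cos (2 * pi * (real j - real i) / real n) = 1"
        unfolding \<omega>_def by (metis cis.simps(1) one_complex.simps(1))
      then obtain m :: int where "2 * pi * (real j - real i) / real n = of_int m * 2 * pi"
        unfolding cos_one_2pi_int by auto
      then have "(2 * pi) * (real j - real i) = (2 * pi) * (of_int m * real n)"
        using n by (simp add: field_simps)
      then have "real j - real i = of_int m * real n"
        by (subst (asm) mult_left_cancel) simp_all
      then have "of_int (int j - int i) = (of_int (m * int n) :: real)"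
        by simp
      then have eq: "int j - int i = m * int n"
        by (simp only: of_int_eq_iff)
      then have "int n dvd int j - int i" by simp
      moreover have "\<bar>int j - int i\<bar> < int n" "int j - int i \<noteq> 0"
        using assms False by auto
      ultimately show False
        using dvd_imp_le_int[of "int j - int i" "int n"] by auto
    qed
    then show ?thesis unfolding sum using False root by (simp add: geometric_sum)
  qed
qed

lemma circulant_mat_entry_eq:
  assumes "circulant_mat n R" "p < n" "q < n" "p' < n" "q' < n"
    and "[int p - int q = int p' - int q'] (mod int n)"
  shows "R $$ (p, q) = R $$ (p', q')"
  using assms(1)[unfolded circulant_mat_def, THEN conjunct2, rule_format, OF assms(2-6)] .

text \<open>Column \<open>q\<close> is column 0 shifted cyclically by \<open>q\<close>.\<close>

lemma circulant_column_sum: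
  fixes M :: "'a :: comm_monoid_add mat"
  assumes "circulant_mat n M" "q < n"
  shows "(\<Sum>p<n. M $$ (p, q)) = (\<Sum>p<n. M $$ (p, 0))"
proof -
  \<comment> \<open>Adding \<open>n\<close> keeps the shift \<open>p - q\<close> inside the natural numbers.\<close>
  define shift where "shift p = (p + n - q) mod n" for p
  have cong: "[int p - int q = int (shift p) - int 0] (mod int n)" for p
  proof -
    have "int (shift p) = (int p - int q + int n) mod int n"
      unfolding shift_def using assms(2) by (simp add: zmod_int of_nat_diff algebra_simps)
    then show ?thesis by (simp add: cong_def)
  qed
  have "inj_on shift {..<n}"
  proof (rule inj_onI)
    fix p p' assume p: "p \<in> {..<n}" "p' \<in> {..<n}" and "shift p = shift p'"
    then have "[int p - int q = int p' - int q] (mod int n)"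
      using cong[of p] cong[of p'] by (metis cong_sym cong_trans)
    then have "[int p = int p'] (mod int n)"
      using cong_add_rcancel[of "int p" "- int q" "int p'" "int n"] by simp
    then show "p = p'" using p by (simp add: cong_def)
  qed
  moreover have "shift ` {..<n} \<subseteq> {..<n}"
    using assms(2) by (auto simp: shift_def)
  ultimately have bij: "bij_betw shift {..<n} {..<n}"
    by (simp add: bij_betw_def endo_inj_surj)
  have "(\<Sum>p<n. M $$ (p, q)) = (\<Sum>p<n. M $$ (shift p, 0))"
  proof (rule sum.cong[OF refl])
    fix p assume "p \<in> {..<n}"
    then have "p < n" "shift p < n" "0 < n" using assms(2) by (simp_all add: shift_def)
    then show "M $$ (p, q) = M $$ (shift p, 0)"
      using circulant_mat_entry_eq[OF assms(1)] assms(2) cong[of p] by blast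
  qed
  also have "\<dots> = (\<Sum>p<n. M $$ (p, 0))"
    by (rule sum.reindex_bij_betw[OF bij])
  finally show ?thesis .
qed

lemma circulant_entrywise:
  assumes "circulant_mat n R" "circulant_mat n S"
  shows "circulant_mat n (mat n n (\<lambda>(p, q). f (R $$ (p, q)) (S $$ (p, q))))"
  unfolding circulant_mat_def
proof (intro conjI allI impI)
  fix p q p' q'
  assume lt: "p < n" "q < n" "p' < n" "q' < n"
    and cong: "[int p - int q = int p' - int q'] (mod int n)"
  have "R $$ (p, q) = R $$ (p', q')"
    by (rule circulant_mat_entry_eq[OF assms(1) lt cong])
  moreover have "S $$ (p, q) = S $$ (p', q')"
    by (rule circulant_mat_entry_eq[OF assms(2) lt cong])
  ultimately show "mat n n (\<lambda>(p, q). f (R $$ (p, q)) (S $$ (p, q))) $$ (p, q)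
      = mat n n (\<lambda>(p, q). f (R $$ (p, q)) (S $$ (p, q))) $$ (p', q')"
    using lt by simp
qed simp

lemma frobenius_inner_fourier_diag:
  assumes "i < n" "j < n"
  shows "frobenius_inner (fourier_diag n i) (fourier_diag n j) = (if i = j then of_nat n else 0)"
proof -
  have "frobenius_inner (fourier_diag n i) (fourier_diag n j)
      = (\<Sum>p<n. \<Sum>q<n. if p = q then cnj (fourier_character n i q) * fourier_character n j q else 0)"
    unfolding frobenius_inner_def fourier_diag_eq_mat_diag
    by (intro sum.cong) (auto simp: mat_diag_def)
  also have "\<dots> = (\<Sum>q<n. cnj (fourier_character n i q) * fourier_character n j q)"
    by simp
  finally show ?thesis by (simp only: fourier_character_orthogonality[OF assms])
qed

text \<open>
  The inner product is the product of a column sum, which depends only on the circulant factors,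
  and a character sum, which depends only on the diagonal ones.
\<close>

lemma frobenius_inner_circulant_fourier_diag:
  assumes R: "circulant_mat n R" and S: "circulant_mat n S"
  shows "frobenius_inner (R * fourier_diag n i) (S * fourier_diag n j)
      = (\<Sum>p<n. cnj (R $$ (p, 0)) * S $$ (p, 0))
        * (\<Sum>q<n. cnj (fourier_character n i q) * fourier_character n j q)"
proof -
  define M where "M = mat n n (\<lambda>(p, q). cnj (R $$ (p, q)) * S $$ (p, q))"
  have M: "circulant_mat n M"
    unfolding M_def by (rule circulant_entrywise[OF R S])
  have carrier: "R \<in> carrier_mat n n" "S \<in> carrier_mat n n"
    using R S by (simp_all add: circulant_mat_def)
  have "frobenius_inner (R * fourier_diag n i) (S * fourier_diag n j)
      = (\<Sum>p<n. \<Sum>q<n. M $$ (p, q) * (cnj (fourier_character n i q) * fourier_character n j q))"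
    unfolding frobenius_inner_def fourier_diag_eq_mat_diag
      mat_diag_mult_right[OF carrier(1)] mat_diag_mult_right[OF carrier(2)]
    by (intro sum.cong) (auto simp: M_def)
  also have "\<dots> = (\<Sum>q<n. (\<Sum>p<n. M $$ (p, q)) * (cnj (fourier_character n i q) * fourier_character n j q))"
    unfolding sum_distrib_right by (rule sum.swap)
  also have "\<dots> = (\<Sum>q<n. (\<Sum>p<n. M $$ (p, 0)) * (cnj (fourier_character n i q) * fourier_character n j q))"
    by (intro sum.cong refl arg_cong2[of _ _ _ _ "(*)"] circulant_column_sum[OF M]) simp
  also have "\<dots> = (\<Sum>p<n. M $$ (p, 0)) * (\<Sum>q<n. cnj (fourier_character n i q) * fourier_character n j q)"
    by (simp only: sum_distrib_left)
  also have "(\<Sum>p<n. M $$ (p, 0)) = (\<Sum>p<n. cnj (R $$ (p, 0)) * S $$ (p, 0))"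
    by (intro sum.cong) (auto simp: M_def)
  finally show ?thesis .
qed

theorem theorem1p6:
  fixes n :: nat and A :: "complex mat" and R :: "nat \<Rightarrow> complex mat"
  assumes "n \<ge> 1"
    and "A \<in> carrier_mat n n"
    and "\<And>k. k < n \<Longrightarrow> circulant_mat n (R k)"
    and "A = (\<Oplus>\<^bsub>module_mat TYPE(complex) n n\<^esub> k \<in> {..<n}. R k * fourier_diag n k)"
  shows "(\<forall>i<n. \<forall>j<n. frobenius_inner (fourier_diag n i) (fourier_diag n j)
            = (if i = j then of_nat n else 0))
       \<and> (\<forall>i<n. \<forall>j<n. i \<noteq> j \<longrightarrow>
            frobenius_inner (R i * fourier_diag n i) (R j * fourier_diag n j) = 0)"
proof (intro conjI allI impI)
  fix i j assume "i < n" "j < n"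
  then show "frobenius_inner (fourier_diag n i) (fourier_diag n j) = (if i = j then of_nat n else 0)"
    by (rule frobenius_inner_fourier_diag)
next
  fix i j assume ij: "i < n" "j < n" "i \<noteq> j"
  show "frobenius_inner (R i * fourier_diag n i) (R j * fourier_diag n j) = 0"
    unfolding frobenius_inner_circulant_fourier_diag[OF assms(3)[OF ij(1)] assms(3)[OF ij(2)]]
      fourier_character_orthogonality[OF ij(1,2)]
    using ij(3) by simp
qed

end
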